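(* Let $(X,d)$ be a complete metric space, let $R_1,\dots,R_N$ be contractive iterated function systems on $X$ with attractors $A_{R_1},\dots,A_{R_N}$, let $\theta=(\theta_1,\theta_2,\dots)\in\Omega=\{1,\dots,N\}^{\mathbb N}$ be a blending sequence, and let $\mathcal A(\theta)$ be the blend of the attractors $A_{R_i}$, $i=1,\dots,N$, by $\theta$. Then: (1) for each $i=1,\dots,N$, $1\le \beta(\theta,i)\le \frac{1}{1-\lambda_{\mathcal R}}$, and $\beta(\theta,i)=1$ if and only if $\theta=(i,i,i,i,\dots)$; (2) for each $i_0\in\{1,\dots,N\}$, $d_H(\mathcal A(\theta),A_{R_{i_0}})\le \beta(\theta,i_0)\,\delta_{i_0}$, where $\delta_{i_0}:=\max_{i=1,\dots,N} d_H\big(F_{R_i}(A_{R_{i_0}}),A_{R_{i_0}}\big)$.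
   Context: $(X,d)$ is a complete metric space. $K^*(X)$ is the set of non-empty compact subsets of $X$, with the Hausdorff--Pompeiu distance $d_H(A,B)=\max(d(A,B),d(B,A))$, where $d(A,B)=\sup_{a\in A}\inf_{b\in B}d(a,b)$; it is a complete metric space. A contractive iterated function system (IFS) $R=(X,f_j,\,j=1,\dots,n)$ is a finite family of maps $f_j:X\to X$ together with numbers $\lambda_j\in[0,1)$ such that $\operatorname{Lip}(f_j)<\lambda_j$ for all $j$; its contractivity constant is $\lambda_R:=\max_j\lambda_j$. Its Hutchinson--Barnsley operator is $F_R(B)=\bigcup_{j=1}^n f_j(B)$; it maps $K^*(X)$ to itself, and its attractor $A_R$ is the unique element of $K^*(X)$ with $F_R(A_R)=A_R$. Given contractive IFSs $R_i=(X,f^i_j,\,j=1,\dots,n_i)$, $i=1,\dots,N$, their blending is the IFS $\mathcal R=(K^*(X),F_{R_i},\,i=1,\dots,N)$ on $(K^*(X),d_H)$, with contractivity constant $\lambda_{\mathcal R}=\max_{i}\lambda_{R_i}<1$. For a blending sequence $\theta=(\theta_1,\theta_2,\dots)\in\Omega:=\{1,\dots,N\}^{\mathbb N}$, the blend of the attractors $A_{R_i}$ by $\theta$ is $$\mathcal A(\theta):=\lim_{k\to\infty}F_{R_{\theta_1}}(F_{R_{\theta_2}}(\cdots F_{R_{\theta_k}}(Z)))\in K^*(X),$$ the limit being in $d_H$; it exists and does not depend on $Z\in K^*(X)$. Put $\gamma_1:=1$ and $\gamma_k:=\lambda_{R_{\theta_1}}\cdots\lambda_{R_{\theta_{k-1}}}$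 for $k\ge2$. The blending coefficient of $\theta$ with respect to $i\in\{1,\dots,N\}$ is $$\beta(\theta,i):=\gamma_1+\sum_{k\ge2,\ \theta_k\ne i}\gamma_k .$$
   Formalization: The "if and only if" in (1) is false as printed: for N≥2, i=1, θ=(2,1,1,…), β(θ,1)=1 although θ≠(1,1,1,…). It is corrected to: β(θ,i)=1 if and only if θ_k=i for all k≥2 (θ_1 arbitrary). *)

theory Defs
  imports "HOL-Analysis.Analysis"
begin

definition Kstar :: "'a::metric_space set set" where
  "Kstar = {K. compact K \<and> K \<noteq> {}}"

definition excess :: "'a::metric_space set \<Rightarrow> 'a set \<Rightarrow> real" where
  "excess A B = (SUP a\<in>A. infdist a B)"

definition hausdorff_dist :: "'a::metric_space set \<Rightarrow> 'a set \<Rightarrow> real" where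
  "hausdorff_dist A B = max (excess A B) (excess B A)"

text \<open>The least Lipschitz constant, with value \<open>\<infinity>\<close> for a map that is not Lipschitz.\<close>

definition Lip :: "('a::metric_space \<Rightarrow> 'b::metric_space) \<Rightarrow> ennreal" where
  "Lip f = (INF C\<in>{C. C-lipschitz_on UNIV f}. ennreal C)"

text \<open>Maps and ratios are indexed by \<open>{1..ifs_size S}\<close>; their values at other indices
  are irrelevant.\<close>

record 'a ifs =
  ifs_size :: nat
  ifs_map :: "nat \<Rightarrow> 'a \<Rightarrow> 'a"
  ifs_ratio :: "nat \<Rightarrow> real"

definition contractive_ifs :: "'a::metric_space ifs \<Rightarrow> bool" where
  "contractive_ifs S \<longleftrightarrow> 1 \<le> ifs_size S \<and>
    (\<forall>j\<in>{1..ifs_size S}. 0 \<le> ifs_ratio S j \<and> ifs_ratio S j < 1 \<and>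
       Lip (ifs_map S j) < ennreal (ifs_ratio S j))"

definition contractivity :: "'a ifs \<Rightarrow> real" where
  "contractivity S = Max (ifs_ratio S ` {1..ifs_size S})"

definition hutchinson :: "'a ifs \<Rightarrow> 'a set \<Rightarrow> 'a set" where
  "hutchinson S B = (\<Union>j\<in>{1..ifs_size S}. ifs_map S j ` B)"

definition attractor :: "'a::metric_space ifs \<Rightarrow> 'a set" where
  "attractor S = (THE A. A \<in> Kstar \<and> hutchinson S A = A)"

text \<open>The blending is an IFS on the metric space \<open>(Kstar, hausdorff_dist)\<close>; its maps are
  represented as functions on all subsets, of which only the values on \<^const>\<open>Kstar\<close> matter.\<close>

definition blending :: "nat \<Rightarrow> (nat \<Rightarrow> 'a ifs) \<Rightarrow> 'a set ifs" where
  "blending N R = \<lparr>ifs_size = N, ifs_map = (\<lambda>i. hutchinson (R i)),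
                   ifs_ratio = (\<lambda>i. contractivity (R i))\<rparr>"

text \<open>Sequences \<open>\<theta>\<close> are indexed from 1; the value \<open>\<theta> 0\<close> is never used.\<close>

definition blending_seqs :: "nat \<Rightarrow> (nat \<Rightarrow> nat) set" where
  "blending_seqs N = {\<theta>. \<forall>k\<ge>1. \<theta> k \<in> {1..N}}"

text \<open>\<open>f\<^bsub>\<theta> 1\<^esub> (f\<^bsub>\<theta> 2\<^esub> (\<dots> f\<^bsub>\<theta> k\<^esub> z))\<close>\<close>

definition ifs_iterate :: "'a ifs \<Rightarrow> (nat \<Rightarrow> nat) \<Rightarrow> nat \<Rightarrow> 'a \<Rightarrow> 'a" where
  "ifs_iterate S \<theta> k z = foldr (\<lambda>j. ifs_map S (\<theta> j)) [1..<Suc k] z"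

definition blend :: "nat \<Rightarrow> (nat \<Rightarrow> 'a::metric_space ifs) \<Rightarrow> (nat \<Rightarrow> nat) \<Rightarrow> 'a set" where
  "blend N R \<theta> = (THE A. A \<in> Kstar \<and>
     (\<forall>Z\<in>Kstar. (\<lambda>k. hausdorff_dist (ifs_iterate (blending N R) \<theta> k Z) A) \<longlonglongrightarrow> 0))"

definition blend_weight :: "(nat \<Rightarrow> 'a ifs) \<Rightarrow> (nat \<Rightarrow> nat) \<Rightarrow> nat \<Rightarrow> real" where
  "blend_weight R \<theta> k = (\<Prod>j\<in>{1..<k}. contractivity (R (\<theta> j)))"

definition blending_coeff :: "(nat \<Rightarrow> 'a ifs) \<Rightarrow> (nat \<Rightarrow> nat) \<Rightarrow> nat \<Rightarrow> real" where
  "blending_coeff R \<theta> i =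
     blend_weight R \<theta> 1 + (\<Sum>\<^sub>\<infinity>k\<in>{k. 2 \<le> k \<and> \<theta> k \<noteq> i}. blend_weight R \<theta> k)"

text \<open>The first summand is 1 whether or not \<open>\<theta> 1 = i\<close>, so the coefficient does not detect the
  first index: it equals 1 for \<open>(j, i, i, i, \<dots>)\<close> with any \<open>j\<close>.\<close>

lemma blending_coeff_eq_1:
  assumes "\<And>k. 2 \<le> k \<Longrightarrow> \<theta> k = i"
  shows "blending_coeff R \<theta> i = 1"
proof -
  have none: "{k. 2 \<le> k \<and> \<theta> k \<noteq> i} = {}"
    using assms by auto
  show ?thesis
    unfolding blending_coeff_def none by (simp add: blend_weight_def)
qed

definition attractor_spread :: "nat \<Rightarrow> (nat \<Rightarrow> 'a::metric_space ifs) \<Rightarrow> nat \<Rightarrow> real" where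
  "attractor_spread N R i0 =
     Max ((\<lambda>i. hausdorff_dist (hutchinson (R i) (attractor (R i0))) (attractor (R i0))) ` {1..N})"

end

theory Submission
  imports Defs
begin

text \<open>
Write \<open>F\<^sub>i\<close> for the Hutchinson operator of \<open>R i\<close>, \<open>\<gamma>\<^sub>k\<close> for the blending weights, \<open>A\<close> for the
attractor of \<open>R i0\<close> and \<open>d\<close> for the Hausdorff distance. The bound on the distance is the collage
argument, applied to the finite compositions \<open>G\<^sub>k = F\<^bsub>\<theta> 1\<^esub> \<circ> \<dots> \<circ> F\<^bsub>\<theta> k\<^esub>\<close>. The ratio of a composition is
at most the product of the ratios of its factors, so
\<open>d (G\<^sub>k A) (G\<^bsub>k-1\<^esub> A) \<le> \<gamma>\<^sub>k * d (F\<^bsub>\<theta> k\<^esub> A) A\<close>: the innermost map moves \<open>A\<close>, and the others shrink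
the displacement. Summation over \<open>k\<close> bounds \<open>d (G\<^sub>k A) A\<close>
(\<open>hausdorff_dist_iterate_self_le\<close>). The terms with \<open>\<theta> k = i0\<close> vanish because \<open>F\<^bsub>i0\<^esub> A = A\<close>, and the
others are at most \<open>\<gamma>\<^sub>k\<close> times the spread; the sum is at most the blending coefficient times the
spread, uniformly in \<open>k\<close>, and the limit of \<open>G\<^sub>k A\<close> is the blend.

The blend and the attractor are given by definite descriptions, so this argument is about them only
once the described sets are known to exist uniquely. Existence rests on the completeness of the
Hausdorff metric (\<open>hausdorff_dist_complete\<close>), applied to the sequence \<open>G\<^sub>k Z\<close>, whose steps
decay geometrically. An attractor is the blend of a single system with itself: its fixed-point
property comes from \<open>G\<^bsub>k+1\<^esub> Z = F (G\<^sub>k Z)\<close>.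

The bounds on the coefficient compare the weights with a geometric series. All ratios are strictly
positive, because each exceeds a Lipschitz constant; hence all weights are positive, and the
coefficient exceeds \<open>1\<close> as soon as its sum has a single term.
\<close>

section \<open>The Hausdorff distance on non-empty compact sets\<close>

lemma infdist_le_iff_Kstar:
  assumes "D \<in> Kstar"
  shows "infdist x D \<le> r \<longleftrightarrow> (\<exists>d\<in>D. dist x d \<le> r)"
proof
  assume le: "infdist x D \<le> r"
  have "continuous_on D (dist x)"
    by (intro continuous_intros)
  then obtain d where d: "d \<in> D" "\<And>y. y \<in> D \<Longrightarrow> dist x d \<le> dist x y"
    using assms continuous_attains_inf[of D "dist x"] by (auto simp: Kstar_def)
  then have "dist x d \<le> infdist x D"
    by (auto simp: infdist_def intro!: cINF_greatest)
  then show "\<exists>d\<in>D. dist x d \<le> r"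
    using d le by force
qed (auto intro: infdist_le2)

text \<open>Compactness makes the infimum in the excess attained and the supremum finite. Without suprema, the metric properties below reduce to statements about single points.\<close>

lemma hausdorff_dist_le_iff:
  assumes "A \<in> Kstar" "B \<in> Kstar"
  shows "hausdorff_dist A B \<le> r \<longleftrightarrow>
    (\<forall>a\<in>A. \<exists>b\<in>B. dist a b \<le> r) \<and> (\<forall>b\<in>B. \<exists>a\<in>A. dist a b \<le> r)"
proof -
  have excess: "excess C D \<le> r \<longleftrightarrow> (\<forall>c\<in>C. \<exists>d\<in>D. dist c d \<le> r)"
    if C: "C \<in> Kstar" and D: "D \<in> Kstar" for C D :: "'a set"
  proof -
    have "compact ((\<lambda>c. infdist c D) ` C)"
      using C by (intro compact_continuous_image continuous_intros) (auto simp: Kstar_def)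
    then have bdd: "bdd_above ((\<lambda>c. infdist c D) ` C)"
      by (intro bounded_imp_bdd_above compact_imp_bounded)
    show ?thesis
      unfolding excess_def infdist_le_iff_Kstar[OF D, symmetric]
      by (rule cSUP_le_iff) (use C bdd in \<open>auto simp: Kstar_def\<close>)
  qed
  show ?thesis
    using excess[OF assms] excess[OF assms(2,1)] by (auto simp: hausdorff_dist_def dist_commute)
qed

lemma hausdorff_dist_attained:
  assumes "A \<in> Kstar" "B \<in> Kstar" "a \<in> A"
  obtains b where "b \<in> B" "dist a b \<le> hausdorff_dist A B"
  using hausdorff_dist_le_iff[OF assms(1,2), of "hausdorff_dist A B"] assms(3) by auto

lemma hausdorff_dist_commute: "hausdorff_dist A B = hausdorff_dist B A"
  by (simp add: hausdorff_dist_def max.commute)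

lemma hausdorff_dist_nonneg:
  assumes "A \<in> Kstar" "B \<in> Kstar"
  shows "0 \<le> hausdorff_dist A B"
proof -
  obtain a where "a \<in> A"
    using assms by (auto simp: Kstar_def)
  then show ?thesis
    using hausdorff_dist_attained[OF assms] by (meson order_trans zero_le_dist)
qed

lemma hausdorff_dist_triangle:
  assumes "A \<in> Kstar" "B \<in> Kstar" "C \<in> Kstar"
  shows "hausdorff_dist A C \<le> hausdorff_dist A B + hausdorff_dist B C"
proof -
  have "\<exists>c\<in>C. dist a c \<le> hausdorff_dist A B + hausdorff_dist B C"
    if sets: "A \<in> Kstar" "B \<in> Kstar" "C \<in> Kstar" and a: "a \<in> A" for A B C :: "'a set" and a
  proof -
    obtain b where b: "b \<in> B" "dist a b \<le> hausdorff_dist A B"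
      using hausdorff_dist_attained[OF sets(1,2) a] .
    obtain c where c: "c \<in> C" "dist b c \<le> hausdorff_dist B C"
      using hausdorff_dist_attained[OF sets(2,3) b(1)] .
    show ?thesis
      using b c dist_triangle[of a c b] by (intro bexI[of _ c]) auto
  qed
  from this[OF assms] this[OF assms(3,2,1)] show ?thesis
    using assms
    by (auto simp: hausdorff_dist_le_iff hausdorff_dist_commute[of B A]
        hausdorff_dist_commute[of C B] dist_commute add.commute)
qed

lemma hausdorff_dist_self:
  assumes "A \<in> Kstar"
  shows "hausdorff_dist A A = 0"
  using hausdorff_dist_le_iff[OF assms assms, of 0] hausdorff_dist_nonneg[OF assms assms]
  by fastforce

lemma hausdorff_dist_le_0_imp_eq:
  assumes "A \<in> Kstar" "B \<in> Kstar" "hausdorff_dist A B \<le> 0"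
  shows "A = B"
  using assms(3) by (force simp: hausdorff_dist_le_iff[OF assms(1,2)])

lemma hausdorff_limit_unique:
  assumes K: "\<And>k. K k \<in> Kstar" "A \<in> Kstar" "B \<in> Kstar"
    and A: "(\<lambda>k. hausdorff_dist (K k) A) \<longlonglongrightarrow> 0"
    and B: "(\<lambda>k. hausdorff_dist (K k) B) \<longlonglongrightarrow> 0"
  shows "A = B"
proof (rule hausdorff_dist_le_0_imp_eq)
  have "(\<lambda>k. hausdorff_dist (K k) A + hausdorff_dist (K k) B) \<longlonglongrightarrow> 0"
    using tendsto_add[OF A B] by simp
  moreover have "hausdorff_dist A B \<le> hausdorff_dist (K k) A + hausdorff_dist (K k) B" for k
    using hausdorff_dist_triangle[OF K(2) K(1) K(3), of k]
    by (simp add: hausdorff_dist_commute[of A])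
  ultimately show "hausdorff_dist A B \<le> 0"
    by (intro LIMSEQ_le_const) auto
qed fact+

text \<open>Completeness, for sequences whose steps are dominated by the decrements of a null sequence \<open>T\<close>; the
triangle inequality then telescopes, and the same \<open>T\<close> bounds the distance to the limit. For a
geometric bound on the steps, \<open>T\<close> is the tail of the geometric series. The limit set consists of the
points within \<open>T k\<close> of every \<open>K k\<close>, which makes it closed, and totally bounded because each \<open>K k\<close> is.
Completeness of the space then makes it compact, and also yields the points of it near a given point
of \<open>K k\<close>, as limits of Cauchy sequences; in particular it is not empty.\<close>

proposition hausdorff_dist_complete:
  fixes K :: "nat \<Rightarrow> 'a::complete_space set" and T :: "nat \<Rightarrow> real"
  assumes K: "\<And>k. K k \<in> Kstar"
    and step: "\<And>k. hausdorff_dist (K k) (K (Suc k)) \<le> T k - T (Suc k)"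
    and T: "T \<longlonglongrightarrow> 0"
  shows "\<exists>A\<in>Kstar. \<forall>k. hausdorff_dist (K k) A \<le> T k"
proof -
  have "T (Suc k) \<le> T k" for k
    using step[of k] hausdorff_dist_nonneg[OF K K, of k "Suc k"] by linarith
  then have dec: "decseq T"
    by (rule decseq_SucI)
  have T_nonneg: "0 \<le> T k" for k
    using decseq_ge[OF dec T] .
  have K_dist: "hausdorff_dist (K k) (K (k + m)) \<le> T k - T (k + m)" for k m
  proof (induction m)
    case 0
    then show ?case by (simp add: hausdorff_dist_self K)
  next
    case (Suc m)
    then show ?case
      using hausdorff_dist_triangle[OF K[of k] K[of "k + m"] K[of "Suc (k + m)"]] step[of "k + m"]
      by simp
  qed
  define A where "A = {x. \<forall>k. infdist x (K k) \<le> T k}"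
  have A_near_K: "\<exists>y\<in>K k. dist x y \<le> T k" if "x \<in> A" for x k
    using that infdist_le_iff_Kstar[OF K] by (simp add: A_def)
  have K_near_A: "\<exists>x\<in>A. dist a x \<le> T k" if a: "a \<in> K k" for a k
  proof -
    \<comment> \<open>Starting from \<open>a\<close>, move from each set to a point of the next one, by at most the Hausdorff
      distance of the two sets; the limit of these points is the required point of \<open>A\<close>.\<close>
    have "\<exists>u. \<forall>n. (u n \<in> K (k + n) \<and> (n = 0 \<longrightarrow> u n = a)) \<and>
        dist (u n) (u (Suc n)) \<le> T (k + n) - T (k + Suc n)"
    proof (rule dependent_nat_choice)
      show "\<exists>x. x \<in> K (k + 0) \<and> (0 = (0::nat) \<longrightarrow> x = a)"
        using a by simp
      fix x n
      assume "x \<in> K (k + n) \<and> (n = 0 \<longrightarrow> x = a)"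
      then obtain y where "y \<in> K (Suc (k + n))"
          "dist x y \<le> hausdorff_dist (K (k + n)) (K (Suc (k + n)))"
        using hausdorff_dist_attained[OF K K] by blast
      then show "\<exists>y. (y \<in> K (k + Suc n) \<and> (Suc n = 0 \<longrightarrow> y = a)) \<and>
          dist x y \<le> T (k + n) - T (k + Suc n)"
        using step[of "k + n"] by force
    qed
    then obtain u where u: "\<And>n. u n \<in> K (k + n)" "u 0 = a"
        "\<And>n. dist (u n) (u (Suc n)) \<le> T (k + n) - T (k + Suc n)"
      by metis
    have u_dist: "dist (u n) (u (n + m)) \<le> T (k + n) - T (k + n + m)" for n m
    proof (induction m)
      case (Suc m)
      then show ?case
        using dist_triangle[of "u n" "u (Suc (n + m))" "u (n + m)"] u(3)[of "n + m"]
        by (simp add: add.assoc)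
    qed simp
    have "Cauchy u"
      unfolding Cauchy_altdef
    proof (intro allI impI)
      fix e :: real
      assume "e > 0"
      then obtain M where M: "\<And>n. n \<ge> M \<Longrightarrow> T n < e"
        using order_tendstoD(2)[OF T] by (auto simp: eventually_sequentially)
      have "dist (u m) (u n) < e" if "m \<ge> M" "n > m" for m n
        using u_dist[of m "n - m"] M[of "k + m"] T_nonneg[of "k + n"] that by simp
      then show "\<exists>M. \<forall>m\<ge>M. \<forall>n>m. dist (u m) (u n) < e"
        by blast
    qed
    then obtain x where x: "u \<longlonglongrightarrow> x"
      using convergent_eq_Cauchy by blast
    have "infdist x (K j) \<le> T j" for j
    proof (rule tendsto_upperbound)
      show "(\<lambda>n. infdist (u n) (K j)) \<longlonglongrightarrow> infdist x (K j)"
        by (intro tendsto_intros x)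
      have "infdist (u n) (K j) \<le> T j" if "n \<ge> j" for n
      proof -
        have "k + n = j + (k + n - j)"
          using that by simp
        then obtain y where "y \<in> K j" "dist (u n) y \<le> T j - T (k + n)"
          using hausdorff_dist_attained[OF K K u(1)[of n], of j] K_dist[of j "k + n - j"]
          by (metis hausdorff_dist_commute order_trans)
        then show ?thesis
          using T_nonneg[of "k + n"] by (intro infdist_le2[of y]) auto
      qed
      then show "\<forall>\<^sub>F n in sequentially. infdist (u n) (K j) \<le> T j"
        by (auto simp: eventually_sequentially)
    qed simp
    then have "x \<in> A"
      by (simp add: A_def)
    moreover have "dist a x \<le> T k"
    proof (rule tendsto_upperbound)
      show "(\<lambda>n. dist a (u n)) \<longlonglongrightarrow> dist a x"
        by (intro tendsto_intros x)
      show "\<forall>\<^sub>F n in sequentially. dist a (u n) \<le> T k"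
        using u_dist[of 0] T_nonneg u(2)
        by (intro always_eventually allI) (smt (verit) add_0 add.right_neutral)
    qed simp
    ultimately show ?thesis
      by blast
  qed
  have "A \<in> Kstar"
  proof -
    have "closed A"
      unfolding A_def Collect_all_eq
      by (intro closed_INT ballI closed_Collect_le continuous_intros)
    moreover have "\<exists>F. finite F \<and> A \<subseteq> (\<Union>x\<in>F. ball x e)" if "e > 0" for e
    proof -
      obtain k where k: "T k < e / 2"
        using order_tendstoD(2)[OF T, of "e / 2"] \<open>e > 0\<close>
        by (auto simp: eventually_sequentially)
      have "compact (K k)"
        using K by (auto simp: Kstar_def)
      then obtain F where F: "finite F" "K k \<subseteq> (\<Union>x\<in>F. ball x (e / 2))"
        using \<open>e > 0\<close> unfolding compact_eq_totally_bounded by (meson half_gt_zero)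
      have "A \<subseteq> (\<Union>x\<in>F. ball x e)"
      proof
        fix x
        assume "x \<in> A"
        then obtain y where y: "y \<in> K k" "dist x y \<le> T k"
          using A_near_K by blast
        then obtain z where z: "z \<in> F" "dist z y < e / 2"
          using F by auto
        have "dist z x < e"
          using dist_triangle[of z x y] y z k by (simp add: dist_commute)
        then show "x \<in> (\<Union>x\<in>F. ball x e)"
          using z by auto
      qed
      then show ?thesis
        using F by blast
    qed
    ultimately have "compact A"
      by (simp add: compact_eq_totally_bounded complete_eq_closed)
    moreover have "A \<noteq> {}"
      using K[of 0] K_near_A by (fastforce simp: Kstar_def)
    ultimately show ?thesis
      by (simp add: Kstar_def)
  qed
  moreover have "hausdorff_dist (K k) A \<le> T k" for k
    using A_near_K K_near_A
    by (auto simp: hausdorff_dist_le_iff[OF K \<open>A \<in> Kstar\<close>] dist_commute)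
  ultimately show ?thesis
    by blast
qed

section \<open>The Hutchinson operator is a contraction\<close>

lemma lipschitz_on_if_Lip_less:
  assumes "Lip f < ennreal c"
  shows "c-lipschitz_on UNIV f"
proof -
  obtain C where "C-lipschitz_on UNIV f" "ennreal C < ennreal c"
    using assms by (auto simp: Lip_def INF_less_iff)
  then show ?thesis
    by (meson ennreal_less_iff less_imp_le lipschitz_on_mono lipschitz_on_nonneg order_refl)
qed

text \<open>The strict inequality between Lipschitz constant and ratio excludes the ratio \<open>0\<close>, even for constant
maps.\<close>

lemma contractivity_pos:
  assumes "contractive_ifs S"
  shows "0 < contractivity S"
proof -
  have "1 \<in> {1..ifs_size S}"
    using assms by (simp add: contractive_ifs_def)
  moreover from this have "Lip (ifs_map S 1) < ennreal (ifs_ratio S 1)"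
    using assms by (simp add: contractive_ifs_def)
  then have "0 < ifs_ratio S 1"
    by (metis ennreal_neg linorder_not_less not_less_zero)
  ultimately show ?thesis
    by (force simp: contractivity_def Max_gr_iff)
qed

lemma contractivity_less_1:
  assumes "contractive_ifs S"
  shows "contractivity S < 1"
  using assms by (auto simp: contractive_ifs_def contractivity_def)

lemma lipschitz_on_ifs_map:
  assumes "contractive_ifs S" "j \<in> {1..ifs_size S}"
  shows "(contractivity S)-lipschitz_on UNIV (ifs_map S j)"
proof -
  have "(ifs_ratio S j)-lipschitz_on UNIV (ifs_map S j)"
    using assms by (auto simp: contractive_ifs_def intro: lipschitz_on_if_Lip_less)
  moreover have "ifs_ratio S j \<le> contractivity S"
    using assms(2) by (simp add: contractivity_def)
  ultimately show ?thesis
    using lipschitz_on_mono by blast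
qed

lemma hutchinson_Kstar:
  assumes S: "contractive_ifs S" and B: "B \<in> Kstar"
  shows "hutchinson S B \<in> Kstar"
proof -
  have "compact (ifs_map S j ` B)" if "j \<in> {1..ifs_size S}" for j
    using B continuous_on_subset[OF lipschitz_on_continuous_on[OF lipschitz_on_ifs_map[OF S that]]]
    by (intro compact_continuous_image) (auto simp: Kstar_def)
  then have "compact (hutchinson S B)"
    unfolding hutchinson_def by (intro compact_UN) auto
  moreover have "hutchinson S B \<noteq> {}"
    using S B by (auto simp: hutchinson_def contractive_ifs_def Kstar_def)
  ultimately show ?thesis
    by (simp add: Kstar_def)
qed

lemma hausdorff_dist_hutchinson_le:
  assumes S: "contractive_ifs S" and "A \<in> Kstar" "B \<in> Kstar"
  shows "hausdorff_dist (hutchinson S A) (hutchinson S B) \<le> contractivity S * hausdorff_dist A B"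
proof -
  have "\<exists>y\<in>hutchinson S D. dist x y \<le> contractivity S * hausdorff_dist C D"
    if C: "C \<in> Kstar" and D: "D \<in> Kstar" and x: "x \<in> hutchinson S C" for C D :: "'a set" and x
  proof -
    obtain j c where j: "j \<in> {1..ifs_size S}" and c: "c \<in> C" "x = ifs_map S j c"
      using x by (auto simp: hutchinson_def)
    obtain d where d: "d \<in> D" "dist c d \<le> hausdorff_dist C D"
      using hausdorff_dist_attained[OF C D c(1)] .
    have "dist x (ifs_map S j d) \<le> contractivity S * dist c d"
      using lipschitz_onD[OF lipschitz_on_ifs_map[OF S j]] c by auto
    also have "\<dots> \<le> contractivity S * hausdorff_dist C D"
      using d contractivity_pos[OF S] by (intro mult_left_mono) auto
    finally show ?thesis
      using j d by (auto simp: hutchinson_def)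
  qed
  from this[OF assms(2,3)] this[OF assms(3,2)] show ?thesis
    using assms
    by (auto simp: hausdorff_dist_le_iff hutchinson_Kstar hausdorff_dist_commute[of B A] dist_commute)
qed

section \<open>The blending weights and the blending coefficient\<close>

lemma blend_weight_Suc:
  assumes "1 \<le> k"
  shows "blend_weight R \<theta> (Suc k) = blend_weight R \<theta> k * contractivity (R (\<theta> k))"
  using assms by (simp add: blend_weight_def atLeastLessThanSuc mult.commute)

lemma blend_weight_1: "blend_weight R \<theta> (Suc 0) = 1"
  by (simp add: blend_weight_def)

locale blended_ifs =
  fixes R :: "nat \<Rightarrow> 'a::complete_space ifs" and N :: nat and \<theta> :: "nat \<Rightarrow> nat"
  assumes contractive: "\<And>i. i \<in> {1..N} \<Longrightarrow> contractive_ifs (R i)"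
    and seq: "\<theta> \<in> blending_seqs N"
begin

abbreviation ratio :: real where
  "ratio \<equiv> contractivity (blending N R)"

abbreviation iterate :: "nat \<Rightarrow> 'a set \<Rightarrow> 'a set" where
  "iterate \<equiv> ifs_iterate (blending N R) \<theta>"

lemma seq_in: "1 \<le> k \<Longrightarrow> \<theta> k \<in> {1..N}"
  using seq by (simp add: blending_seqs_def)

lemma ratio_bounds: "0 < ratio" "ratio < 1" "\<And>i. i \<in> {1..N} \<Longrightarrow> contractivity (R i) \<le> ratio"
proof -
  have ratio: "ratio = (MAX i\<in>{1..N}. contractivity (R i))"
    by (simp add: contractivity_def blending_def)
  have "\<theta> 1 \<in> {1..N}"
    by (rule seq_in) simp
  then have ne: "{1..N} \<noteq> {}"
    by blast
  show le: "contractivity (R i) \<le> ratio" if "i \<in> {1..N}" for i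
    using that by (simp add: ratio)
  show "ratio < 1"
    using ne contractivity_less_1[OF contractive] by (simp add: ratio)
  show "0 < ratio"
    using le[OF \<open>\<theta> 1 \<in> {1..N}\<close>] contractivity_pos[OF contractive[OF \<open>\<theta> 1 \<in> {1..N}\<close>]] by linarith
qed

lemma blend_weight_pos: "0 < blend_weight R \<theta> k"
  unfolding blend_weight_def
  by (intro prod_pos ballI contractivity_pos contractive seq_in) simp

lemma blend_weight_le: "blend_weight R \<theta> (Suc k) \<le> ratio ^ k"
proof (induction k)
  case (Suc k)
  have "blend_weight R \<theta> (Suc k) * contractivity (R (\<theta> (Suc k))) \<le> ratio ^ k * ratio"
    using Suc ratio_bounds seq_in[of "Suc k"] contractivity_pos[OF contractive[OF seq_in, of "Suc k"]]
    by (intro mult_mono) auto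
  then show ?case
    by (simp add: blend_weight_Suc mult.commute)
qed (simp add: blend_weight_1)

text \<open>The summand \<open>1\<close> is the weight of index \<open>1\<close>, so the left-hand side is a sum of distinct weights and is
dominated by the full geometric series.\<close>

lemma finite_sum_blend_weight_le:
  assumes "finite F" "F \<subseteq> {2..}"
  shows "1 + sum (blend_weight R \<theta>) F \<le> 1 / (1 - ratio)"
proof -
  obtain n where n: "F \<subseteq> {..<Suc n}"
    using finite_nat_iff_bounded assms(1)
    by (metis lessThan_subset_iff less_or_eq_imp_le order_trans lessI)
  have "1 + sum (blend_weight R \<theta>) F = sum (blend_weight R \<theta>) (insert 1 F)"
    using assms by (subst sum.insert) (auto simp: blend_weight_1)
  also have "\<dots> \<le> sum (blend_weight R \<theta>) (Suc ` {..<Suc n})"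
  proof (rule sum_mono2)
    show "insert 1 F \<subseteq> Suc ` {..<Suc n}"
    proof
      fix k assume "k \<in> insert 1 F"
      then have "1 \<le> k" "k < Suc (Suc n)"
        using assms(2) n by auto
      then show "k \<in> Suc ` {..<Suc n}"
        by (cases k) auto
    qed
  qed (auto intro: less_imp_le blend_weight_pos)
  also have "\<dots> = (\<Sum>k<Suc n. blend_weight R \<theta> (Suc k))"
    by (simp add: sum.reindex del: sum.lessThan_Suc)
  also have "\<dots> \<le> (\<Sum>k<Suc n. ratio ^ k)"
    by (intro sum_mono blend_weight_le)
  also have "\<dots> \<le> 1 / (1 - ratio)"
    using sum_le_suminf[OF summable_geometric[of ratio], of "{..<Suc n}"] ratio_bounds(1,2)
      suminf_geometric[of ratio] by simp
  finally show ?thesis .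
qed

lemma blend_weight_summable:
  assumes "A \<subseteq> {2..}"
  shows "blend_weight R \<theta> summable_on A"
proof (rule nonneg_bdd_above_summable_on)
  have "sum (blend_weight R \<theta>) F \<le> 1 / (1 - ratio) - 1" if "finite F" "F \<subseteq> A" for F
    using finite_sum_blend_weight_le[of F] that assms by (simp add: subset_trans algebra_simps)
  then show "bdd_above (sum (blend_weight R \<theta>) ` {F. F \<subseteq> A \<and> finite F})"
    by (auto intro!: bdd_aboveI[of _ "1 / (1 - ratio) - 1"])
qed (rule less_imp_le[OF blend_weight_pos])

lemma finite_sum_le_blending_coeff:
  assumes "finite F" "F \<subseteq> {k. 2 \<le> k \<and> \<theta> k \<noteq> i}"
  shows "1 + sum (blend_weight R \<theta>) F \<le> blending_coeff R \<theta> i"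
  unfolding blending_coeff_def One_nat_def blend_weight_1
  using assms
  by (intro add_left_mono finite_sum_le_infsum blend_weight_summable)
     (auto intro: less_imp_le blend_weight_pos)

lemma blending_coeff_le: "blending_coeff R \<theta> i \<le> 1 / (1 - ratio)"
proof -
  have "infsum (blend_weight R \<theta>) {k. 2 \<le> k \<and> \<theta> k \<noteq> i} \<le> 1 / (1 - ratio) - 1"
  proof (rule infsum_le_finite_sums)
    show "sum (blend_weight R \<theta>) F \<le> 1 / (1 - ratio) - 1"
      if "finite F" "F \<subseteq> {k. 2 \<le> k \<and> \<theta> k \<noteq> i}" for F
      using finite_sum_blend_weight_le[of F] that by fastforce
  qed (auto intro: blend_weight_summable)
  then show ?thesis
    by (simp add: blending_coeff_def blend_weight_1)
qed

lemma blending_coeff_eq_1_iff: "blending_coeff R \<theta> i = 1 \<longleftrightarrow> (\<forall>k\<ge>2. \<theta> k = i)"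
proof
  assume eq: "blending_coeff R \<theta> i = 1"
  show "\<forall>k\<ge>2. \<theta> k = i"
  proof (rule ccontr)
    assume "\<not> (\<forall>k\<ge>2. \<theta> k = i)"
    then obtain k where "2 \<le> k" "\<theta> k \<noteq> i"
      by blast
    then show False
      using finite_sum_le_blending_coeff[of "{k}" i] blend_weight_pos[of k] eq by simp
  qed
qed (auto intro: blending_coeff_eq_1)

section \<open>Convergence to the blend and to the attractor\<close>

lemma iterate_0: "iterate 0 Z = Z"
  by (simp add: ifs_iterate_def)

lemma iterate_Suc: "iterate (Suc k) Z = iterate k (hutchinson (R (\<theta> (Suc k))) Z)"
  by (simp add: ifs_iterate_def blending_def)

lemma hutchinson_seq_Kstar: "Z \<in> Kstar \<Longrightarrow> hutchinson (R (\<theta> (Suc k))) Z \<in> Kstar"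
  by (intro hutchinson_Kstar contractive seq_in) auto

lemma iterate_Kstar: "Z \<in> Kstar \<Longrightarrow> iterate k Z \<in> Kstar"
  by (induction k arbitrary: Z) (auto simp: iterate_0 iterate_Suc hutchinson_seq_Kstar)

lemma hausdorff_dist_iterate_le:
  assumes "Y \<in> Kstar" "Z \<in> Kstar"
  shows "hausdorff_dist (iterate k Y) (iterate k Z)
      \<le> blend_weight R \<theta> (Suc k) * hausdorff_dist Y Z"
  using assms
proof (induction k arbitrary: Y Z)
  case 0
  then show ?case by (simp add: iterate_0 blend_weight_1)
next
  case (Suc k)
  let ?F = "hutchinson (R (\<theta> (Suc k)))"
  have "hausdorff_dist (iterate (Suc k) Y) (iterate (Suc k) Z)
      \<le> blend_weight R \<theta> (Suc k) * hausdorff_dist (?F Y) (?F Z)"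
    unfolding iterate_Suc using Suc by (intro Suc.IH hutchinson_seq_Kstar)
  also have "\<dots> \<le> blend_weight R \<theta> (Suc k) * (contractivity (R (\<theta> (Suc k))) * hausdorff_dist Y Z)"
    using Suc.prems
    by (intro mult_left_mono hausdorff_dist_hutchinson_le contractive seq_in)
       (auto intro: less_imp_le blend_weight_pos)
  finally show ?case
    by (simp add: blend_weight_Suc mult.assoc)
qed

text \<open>The two compositions differ only in the innermost map, so the outer \<open>k\<close> maps contract the
displacement that this map causes.\<close>

lemma hausdorff_dist_iterate_Suc_le:
  assumes "Z \<in> Kstar"
  shows "hausdorff_dist (iterate (Suc k) Z) (iterate k Z)
      \<le> blend_weight R \<theta> (Suc k) * hausdorff_dist (hutchinson (R (\<theta> (Suc k))) Z) Z"
  unfolding iterate_Suc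
  using assms by (intro hausdorff_dist_iterate_le hutchinson_seq_Kstar)

text \<open>For a singleton \<open>Z\<close> the steps decay geometrically, so the sequence converges; any other starting set
has the same limit because the ratio of the \<open>k\<close>-fold composition tends to \<open>0\<close>.\<close>

lemma iterate_convergent:
  "\<exists>A\<in>Kstar. \<forall>Z\<in>Kstar. (\<lambda>k. hausdorff_dist (iterate k Z) A) \<longlonglongrightarrow> 0"
proof -
  fix x :: 'a
  let ?X = "{x}"
  have X: "?X \<in> Kstar"
    by (simp add: Kstar_def)
  define M where "M = (MAX i\<in>{1..N}. hausdorff_dist (hutchinson (R i) ?X) ?X)"
  \<comment> \<open>\<open>T k\<close> is the tail \<open>\<Sum>j\<ge>k. M * ratio ^ j\<close> of the bounds on the steps.\<close>
  define T where "T k = M * ratio ^ k / (1 - ratio)" for k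
  have M: "hausdorff_dist (hutchinson (R i) ?X) ?X \<le> M" if "i \<in> {1..N}" for i
    using that by (simp add: M_def)
  have power_tendsto: "(\<lambda>k. ratio ^ k) \<longlonglongrightarrow> 0"
    using ratio_bounds by (intro LIMSEQ_realpow_zero) auto
  have "T \<longlonglongrightarrow> 0"
    unfolding T_def using tendsto_mult_right[OF power_tendsto, of "M / (1 - ratio)"]
    by (simp add: mult.commute)
  moreover have "hausdorff_dist (iterate k ?X) (iterate (Suc k) ?X) \<le> T k - T (Suc k)" for k
  proof -
    have "hausdorff_dist (iterate k ?X) (iterate (Suc k) ?X)
        \<le> blend_weight R \<theta> (Suc k) * hausdorff_dist (hutchinson (R (\<theta> (Suc k))) ?X) ?X"
      using hausdorff_dist_iterate_Suc_le[OF X] by (simp add: hausdorff_dist_commute)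
    also have "\<dots> \<le> ratio ^ k * M"
      using ratio_bounds blend_weight_le M[OF seq_in] hutchinson_seq_Kstar[OF X] X
      by (intro mult_mono) (auto intro: hausdorff_dist_nonneg)
    also have "\<dots> = T k - T (Suc k)"
    proof -
      have "T k - T (Suc k) = M * ratio ^ k * (1 - ratio) / (1 - ratio)"
        unfolding T_def diff_divide_distrib[symmetric] by (simp add: algebra_simps)
      then show "ratio ^ k * M = T k - T (Suc k)"
        using ratio_bounds(2) by simp
    qed
    finally show ?thesis .
  qed
  ultimately obtain A where A: "A \<in> Kstar" "\<And>k. hausdorff_dist (iterate k ?X) A \<le> T k"
    using hausdorff_dist_complete[of "\<lambda>k. iterate k ?X" T] iterate_Kstar[OF X] by blast
  have "(\<lambda>k. hausdorff_dist (iterate k Z) A) \<longlonglongrightarrow> 0" if Z: "Z \<in> Kstar" for Z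
  proof (rule tendsto_sandwich)
    show "\<forall>\<^sub>F k in sequentially. 0 \<le> hausdorff_dist (iterate k Z) A"
      using hausdorff_dist_nonneg[OF iterate_Kstar[OF Z] A(1)] by simp
    show "(\<lambda>k. ratio ^ k * hausdorff_dist Z ?X + T k) \<longlonglongrightarrow> 0"
      using tendsto_add[OF tendsto_mult_left_zero[OF power_tendsto] \<open>T \<longlonglongrightarrow> 0\<close>] by simp
    have "hausdorff_dist (iterate k Z) A \<le> ratio ^ k * hausdorff_dist Z ?X + T k" for k
    proof -
      have "hausdorff_dist (iterate k Z) A
          \<le> hausdorff_dist (iterate k Z) (iterate k ?X) + hausdorff_dist (iterate k ?X) A"
        by (intro hausdorff_dist_triangle iterate_Kstar X Z A)
      moreover have "hausdorff_dist (iterate k Z) (iterate k ?X)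
          \<le> blend_weight R \<theta> (Suc k) * hausdorff_dist Z ?X"
        by (intro hausdorff_dist_iterate_le X Z)
      moreover have "\<dots> \<le> ratio ^ k * hausdorff_dist Z ?X"
        by (intro mult_right_mono blend_weight_le hausdorff_dist_nonneg X Z)
      ultimately show ?thesis
        using A(2)[of k] by linarith
    qed
    then show "\<forall>\<^sub>F k in sequentially.
        hausdorff_dist (iterate k Z) A \<le> ratio ^ k * hausdorff_dist Z ?X + T k"
      by simp
  qed simp
  then show ?thesis
    using A(1) by blast
qed

lemma blend_Kstar_and_limit:
  "blend N R \<theta> \<in> Kstar \<and>
    (\<forall>Z\<in>Kstar. (\<lambda>k. hausdorff_dist (iterate k Z) (blend N R \<theta>)) \<longlonglongrightarrow> 0)"
  unfolding blend_def
proof (rule theI')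
  fix x :: 'a
  have X: "{x} \<in> Kstar"
    by (simp add: Kstar_def)
  obtain A where A: "A \<in> Kstar \<and> (\<forall>Z\<in>Kstar. (\<lambda>k. hausdorff_dist (iterate k Z) A) \<longlonglongrightarrow> 0)"
    using iterate_convergent by blast
  then show "\<exists>!A. A \<in> Kstar \<and> (\<forall>Z\<in>Kstar. (\<lambda>k. hausdorff_dist (iterate k Z) A) \<longlonglongrightarrow> 0)"
  proof (rule ex1I)
    fix B
    assume "B \<in> Kstar \<and> (\<forall>Z\<in>Kstar. (\<lambda>k. hausdorff_dist (iterate k Z) B) \<longlonglongrightarrow> 0)"
    then show "B = A"
      using A X by (intro hausdorff_limit_unique[OF iterate_Kstar[OF X]]) auto
  qed
qed

end

text \<open>The constant sequence of a single system turns the composition into a power of its Hutchinson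
operator. The limit of the powers is a fixed point by continuity, and it is the only one because the
powers started at a fixed point are constant.\<close>

lemma attractor_Kstar_and_fixed:
  fixes S :: "'a::complete_space ifs"
  assumes S: "contractive_ifs S"
  shows "attractor S \<in> Kstar \<and> hutchinson S (attractor S) = attractor S"
  unfolding attractor_def
proof (rule theI')
  interpret blended_ifs "\<lambda>_. S" 1 "\<lambda>_. 1"
    by unfold_locales (use S in \<open>auto simp: blending_seqs_def\<close>)
  obtain A where A: "A \<in> Kstar" "\<And>Z. Z \<in> Kstar \<Longrightarrow> (\<lambda>k. hausdorff_dist (iterate k Z) A) \<longlonglongrightarrow> 0"
    using iterate_convergent by blast
  note FA = hutchinson_Kstar[OF S A(1)]
  have iterate_outer: "iterate (Suc k) Z = hutchinson S (iterate k Z)" for k Z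
    by (induction k arbitrary: Z) (simp_all add: iterate_0 iterate_Suc del: One_nat_def)
  have "(\<lambda>k. hausdorff_dist (iterate k A) (hutchinson S A)) \<longlonglongrightarrow> 0"
  proof (rule LIMSEQ_imp_Suc, rule tendsto_sandwich)
    show "\<forall>\<^sub>F k in sequentially. 0 \<le> hausdorff_dist (iterate (Suc k) A) (hutchinson S A)"
      by (intro always_eventually allI hausdorff_dist_nonneg iterate_Kstar A FA)
    show "(\<lambda>k. contractivity S * hausdorff_dist (iterate k A) A) \<longlonglongrightarrow> 0"
      using tendsto_mult_right_zero[OF A(2)[OF A(1)]] .
    show "\<forall>\<^sub>F k in sequentially. hausdorff_dist (iterate (Suc k) A) (hutchinson S A)
        \<le> contractivity S * hausdorff_dist (iterate k A) A"
      unfolding iterate_outer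
      by (intro always_eventually allI hausdorff_dist_hutchinson_le S iterate_Kstar A)
  qed simp
  then have fixed: "hutchinson S A = A"
    using hausdorff_limit_unique[where K = "\<lambda>k. iterate k A", OF iterate_Kstar[OF A(1)] FA A(1)] A
    by blast
  show "\<exists>!A. A \<in> Kstar \<and> hutchinson S A = A"
  proof (rule ex1I[of _ A])
    fix B
    assume B: "B \<in> Kstar \<and> hutchinson S B = B"
    then have "iterate k B = B" for k
      by (induction k) (simp_all add: iterate_0 iterate_Suc del: One_nat_def)
    then show "B = A"
      using A(2)[of B] B hausdorff_dist_le_0_imp_eq[of B A] A(1) by (simp add: LIMSEQ_const_iff)
  qed (use A fixed in auto)
qed

section \<open>The distance from the blend to an attractor\<close>

context blended_ifs
begin

lemma hausdorff_dist_iterate_self_le: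
  assumes "Z \<in> Kstar"
  shows "hausdorff_dist (iterate k Z) Z
      \<le> (\<Sum>j=1..k. blend_weight R \<theta> j * hausdorff_dist (hutchinson (R (\<theta> j)) Z) Z)"
proof (induction k)
  case 0
  then show ?case by (simp add: iterate_0 hausdorff_dist_self assms)
next
  case (Suc k)
  then show ?case
    using hausdorff_dist_triangle[OF iterate_Kstar iterate_Kstar assms, of Z Z "Suc k" k]
      hausdorff_dist_iterate_Suc_le[OF assms, of k] assms by simp
qed

theorem hausdorff_dist_blend_attractor_le:
  assumes i0: "i0 \<in> {1..N}"
  shows "hausdorff_dist (blend N R \<theta>) (attractor (R i0))
      \<le> blending_coeff R \<theta> i0 * attractor_spread N R i0"
proof -
  let ?A = "attractor (R i0)" and ?\<delta> = "attractor_spread N R i0" and ?w = "blend_weight R \<theta>"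
  have A: "?A \<in> Kstar" and fixed: "hutchinson (R i0) ?A = ?A"
    using attractor_Kstar_and_fixed[OF contractive[OF i0]] by auto
  have spread: "hausdorff_dist (hutchinson (R i) ?A) ?A \<le> ?\<delta>" if "i \<in> {1..N}" for i
    using that by (simp add: attractor_spread_def)
  have spread_nonneg: "0 \<le> ?\<delta>"
    using spread[OF i0] by (simp add: fixed hausdorff_dist_self A)
  have bound: "hausdorff_dist (iterate k ?A) ?A \<le> blending_coeff R \<theta> i0 * ?\<delta>" for k
  proof -
    let ?F = "{j \<in> {2..k}. \<theta> j \<noteq> i0}"
    let ?d = "\<lambda>j. ?w j * hausdorff_dist (hutchinson (R (\<theta> j)) ?A) ?A"
    have d_le: "?d j \<le> ?w j * ?\<delta>" if "1 \<le> j" for j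
      by (intro mult_left_mono spread seq_in that less_imp_le blend_weight_pos)
    have d_nonneg: "0 \<le> ?d j" if "1 \<le> j" for j
      by (intro mult_nonneg_nonneg less_imp_le[OF blend_weight_pos] hausdorff_dist_nonneg
          hutchinson_Kstar contractive seq_in that A)
    have "hausdorff_dist (iterate k ?A) ?A \<le> (\<Sum>j=1..k. ?d j)"
      by (rule hausdorff_dist_iterate_self_le[OF A])
    \<comment> \<open>The blending coefficient counts index \<open>1\<close> whatever \<open>\<theta> 1\<close> is, so only later indices are dropped
      when \<open>\<theta> j = i0\<close>; adjoining \<open>1\<close> makes \<open>k = 0\<close> the same case.\<close>
    also have "\<dots> \<le> (\<Sum>j\<in>insert 1 {2..k}. ?d j)"
      by (rule sum_mono2) (auto intro!: d_nonneg)
    also have "\<dots> = (\<Sum>j\<in>insert 1 ?F. ?d j)"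
      by (rule sum.mono_neutral_right) (auto simp: fixed hausdorff_dist_self A)
    also have "\<dots> \<le> (\<Sum>j\<in>insert 1 ?F. ?w j * ?\<delta>)"
      by (rule sum_mono) (auto intro!: d_le)
    also have "\<dots> = (1 + sum ?w ?F) * ?\<delta>"
      by (simp add: sum_distrib_right[symmetric] blend_weight_1)
    also have "\<dots> \<le> blending_coeff R \<theta> i0 * ?\<delta>"
      by (intro mult_right_mono finite_sum_le_blending_coeff spread_nonneg) auto
    finally show ?thesis .
  qed
  have B: "blend N R \<theta> \<in> Kstar" "(\<lambda>k. hausdorff_dist (iterate k ?A) (blend N R \<theta>)) \<longlonglongrightarrow> 0"
    using blend_Kstar_and_limit A by auto
  show ?thesis
  proof (rule tendsto_lowerbound)
    show "(\<lambda>k. hausdorff_dist (iterate k ?A) (blend N R \<theta>) + blending_coeff R \<theta> i0 * ?\<delta>)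
        \<longlonglongrightarrow> blending_coeff R \<theta> i0 * ?\<delta>"
      using tendsto_add[OF B(2) tendsto_const] by simp
    show "\<forall>\<^sub>F k in sequentially. hausdorff_dist (blend N R \<theta>) ?A
        \<le> hausdorff_dist (iterate k ?A) (blend N R \<theta>) + blending_coeff R \<theta> i0 * ?\<delta>"
      using bound hausdorff_dist_triangle[OF B(1) iterate_Kstar[OF A] A]
      by (intro always_eventually allI) (smt (verit) hausdorff_dist_commute)
  qed simp
qed

end

theorem theorem3p5:
  fixes R :: "nat \<Rightarrow> 'a::complete_space ifs" and N :: nat and \<theta> :: "nat \<Rightarrow> nat"
  assumes "\<And>i. i \<in> {1..N} \<Longrightarrow> contractive_ifs (R i)"
    and "\<theta> \<in> blending_seqs N"
  shows "(\<forall>i\<in>{1..N}.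
            1 \<le> blending_coeff R \<theta> i \<and>
            blending_coeff R \<theta> i \<le> 1 / (1 - contractivity (blending N R)) \<and>
            (blending_coeff R \<theta> i = 1 \<longleftrightarrow> (\<forall>k\<ge>2. \<theta> k = i))) \<and>
         (\<forall>i0\<in>{1..N}.
            hausdorff_dist (blend N R \<theta>) (attractor (R i0))
              \<le> blending_coeff R \<theta> i0 * attractor_spread N R i0)"
proof -
  interpret blended_ifs R N \<theta>
    by unfold_locales (use assms in auto)
  have "1 \<le> blending_coeff R \<theta> i" for i
    using finite_sum_le_blending_coeff[of "{}" i] by simp
  then show ?thesis
    using blending_coeff_le blending_coeff_eq_1_iff hausdorff_dist_blend_attractor_le by blast
qed

end
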